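(* Let $L$ be a non-negative densely defined self-adjoint operator on $L^2(\mathbb{R}^n)$ with heat semigroup $\{e^{-tL}\}_{t>0}$, let $f\in\operatorname{Dom}(L)$ and let $x\in\mathbb{R}^n$ be fixed. Assume that $$\lim_{t\to0^+}\frac{f(x)-e^{-tL}f(x)}{t}=Lf(x),\qquad \lim_{t\to\infty}e^{-tL}f(x)=0,$$ that there are constants $\eta_1,C_1>0$ with $$\left|\frac{f(x)-e^{-tL}f(x)}{t}\right|\le C_1t^{-\eta_1}\quad\text{for all }t\ge1,$$ and that there are constants $\eta_2,C_2>0$ with $$|f(x)-e^{-tL}f(x)|\le C_2t^{\eta_2}\quad\text{for all }0<t\le1.$$ Then $$\lim_{\sigma\to1^-}L^\sigma f(x)=Lf(x),\qquad \lim_{\sigma\to0^+}L^\sigma f(x)=f(x).$$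
   Context: For $0<\sigma<1$ the fractional power is given (pointwise at $x$) by $$L^\sigma f(x)=\frac{1}{\Gamma(-\sigma)}\int_0^\infty\left(e^{-tL}f(x)-f(x)\right)\frac{dt}{t^{1+\sigma}},$$ where $\Gamma$ is the Euler Gamma function. The values $f(x)$, $Lf(x)$ and $e^{-tL}f(x)$ are those of fixed pointwise-defined representatives (with $t\mapsto e^{-tL}f(x)$ measurable). *)

theory Defs
  imports "HOL-Analysis.Analysis"
begin

text \<open>
  The space \<open>L\<^sup>2(\<real>\<^sup>n)\<close> is handled through its (complex-valued) representatives: square-integrable
  functions on \<open>real ^ 'n\<close>, with equality almost everywhere in place of equality of classes.
\<close>

definition L2 :: "(real ^ 'n \<Rightarrow> complex) set" where
  "L2 = {f \<in> borel_measurable lebesgue. integrable lebesgue (\<lambda>x. (cmod (f x))\<^sup>2)}"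

definition ae_eq :: "(real ^ 'n \<Rightarrow> complex) \<Rightarrow> (real ^ 'n \<Rightarrow> complex) \<Rightarrow> bool" where
  "ae_eq f g \<longleftrightarrow> (AE x in lebesgue. f x = g x)"

definition l2_inner :: "(real ^ 'n \<Rightarrow> complex) \<Rightarrow> (real ^ 'n \<Rightarrow> complex) \<Rightarrow> complex" where
  "l2_inner f g = (LINT x|lebesgue. f x * cnj (g x))"

definition l2_norm :: "(real ^ 'n \<Rightarrow> complex) \<Rightarrow> real" where
  "l2_norm f = sqrt (LINT x|lebesgue. (cmod (f x))\<^sup>2)"

text \<open>
  An unbounded operator is given by its graph. The graph is closed under change of
  representatives, so \<open>(f, g) \<in> T\<close> says that \<open>f\<close> represents an element of \<open>Dom(T)\<close> and
  that \<open>g\<close> is some representative of \<open>T f\<close>.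
\<close>

type_synonym 'n l2_graph = "((real ^ 'n \<Rightarrow> complex) \<times> (real ^ 'n \<Rightarrow> complex)) set"

definition l2_operator :: "'n::finite l2_graph \<Rightarrow> bool" where
  "l2_operator T \<longleftrightarrow>
     T \<subseteq> L2 \<times> L2 \<and>
     (\<forall>f g f' g'. (f, g) \<in> T \<longrightarrow> f' \<in> L2 \<longrightarrow> g' \<in> L2 \<longrightarrow> ae_eq f f' \<longrightarrow> ae_eq g g' \<longrightarrow> (f', g') \<in> T) \<and>
     (\<forall>f g f' g'. (f, g) \<in> T \<longrightarrow> (f', g') \<in> T \<longrightarrow> ae_eq f f' \<longrightarrow> ae_eq g g') \<and>
     (\<lambda>x. 0, \<lambda>x. 0) \<in> T \<and>
     (\<forall>f g f' g' a b. (f, g) \<in> T \<longrightarrow> (f', g') \<in> T \<longrightarrow>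
        (\<lambda>x. a * f x + b * f' x, \<lambda>x. a * g x + b * g' x) \<in> T)"

definition densely_defined :: "'n::finite l2_graph \<Rightarrow> bool" where
  "densely_defined T \<longleftrightarrow> (\<forall>f\<in>L2. \<forall>\<epsilon>>0. \<exists>g\<in>Domain T. l2_norm (\<lambda>x. f x - g x) < \<epsilon>)"

definition l2_adjoint :: "'n::finite l2_graph \<Rightarrow> 'n l2_graph" where
  "l2_adjoint T = {(g, h). g \<in> L2 \<and> h \<in> L2 \<and> (\<forall>(f, k)\<in>T. l2_inner k g = l2_inner f h)}"

definition self_adjoint :: "'n::finite l2_graph \<Rightarrow> bool" where
  "self_adjoint T \<longleftrightarrow> l2_adjoint T = T"

definition nonnegative :: "'n::finite l2_graph \<Rightarrow> bool" where
  "nonnegative T \<longleftrightarrow> (\<forall>(f, g)\<in>T. l2_inner g f \<in> \<real> \<and> 0 \<le> Re (l2_inner g f))"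

text \<open>
  Projection-valued measures on the Borel sets of \<open>\<real>\<close>. That \<open>E B\<close> is linear and compatible with
  equality almost everywhere follows from its symmetry, that it is idempotent
  from multiplicativity.
\<close>

definition spectral_measure ::
    "(real set \<Rightarrow> (real ^ 'n \<Rightarrow> complex) \<Rightarrow> (real ^ 'n \<Rightarrow> complex)) \<Rightarrow> bool" where
  "spectral_measure E \<longleftrightarrow>
     (\<forall>B\<in>sets borel. \<forall>f\<in>L2. E B f \<in> L2) \<and>
     (\<forall>B\<in>sets borel. \<forall>f\<in>L2. \<forall>g\<in>L2. l2_inner (E B f) g = l2_inner f (E B g)) \<and>
     (\<forall>A\<in>sets borel. \<forall>B\<in>sets borel. \<forall>f\<in>L2. ae_eq (E (A \<inter> B) f) (E A (E B f))) \<and>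
     (\<forall>f\<in>L2. ae_eq (E UNIV f) f) \<and>
     (\<forall>A::nat \<Rightarrow> real set. range A \<subseteq> sets borel \<longrightarrow> disjoint_family A \<longrightarrow>
        (\<forall>f\<in>L2. \<forall>g\<in>L2. (\<lambda>i. l2_inner (E (A i) f) g) sums l2_inner (E (\<Union>i. A i) f) g))"

definition scalar_measure ::
    "(real set \<Rightarrow> (real ^ 'n \<Rightarrow> complex) \<Rightarrow> (real ^ 'n \<Rightarrow> complex)) \<Rightarrow>
     (real ^ 'n \<Rightarrow> complex) \<Rightarrow> real measure" where
  "scalar_measure E f = measure_of UNIV (sets borel) (\<lambda>B. ennreal (Re (l2_inner (E B f) f)))"

definition spectral_domain ::
    "(real set \<Rightarrow> (real ^ 'n \<Rightarrow> complex) \<Rightarrow> (real ^ 'n \<Rightarrow> complex)) \<Rightarrow>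
     (real \<Rightarrow> real) \<Rightarrow> (real ^ 'n \<Rightarrow> complex) set" where
  "spectral_domain E \<phi> = {f \<in> L2. integrable (scalar_measure E f) (\<lambda>s. (\<phi> s)\<^sup>2)}"

text \<open>
  The operator \<open>\<integral> \<phi> dE\<close>, determined by \<open>\<langle>(\<integral> \<phi> dE) f, h\<rangle> = \<integral> \<phi> d\<langle>E f, h\<rangle>\<close>. The complex
  measure \<open>\<langle>E f, h\<rangle>\<close> is expanded by polarization into the four positive measures
  \<open>\<langle>E (f + \<i>\<^sup>k h), f + \<i>\<^sup>k h\<rangle>\<close>. For unbounded \<open>\<phi>\<close> the four integrals converge when
  \<open>h\<close>, too, lies in the domain; as the domain is dense, such \<open>h\<close> suffice to determine the operator.
\<close>

definition spectral_integral ::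
    "(real set \<Rightarrow> (real ^ 'n \<Rightarrow> complex) \<Rightarrow> (real ^ 'n \<Rightarrow> complex)) \<Rightarrow>
     (real \<Rightarrow> real) \<Rightarrow> 'n::finite l2_graph" where
  "spectral_integral E \<phi> =
     {(f, g). f \<in> spectral_domain E \<phi> \<and> g \<in> L2 \<and>
        (\<forall>h\<in>spectral_domain E \<phi>.
           l2_inner g h =
             (\<Sum>k<4. \<i> ^ k * complex_of_real
                (LINT s|scalar_measure E (\<lambda>x. f x + \<i> ^ k * h x). \<phi> s)) / 4)}"

definition spectral_resolution ::
    "(real set \<Rightarrow> (real ^ 'n \<Rightarrow> complex) \<Rightarrow> (real ^ 'n \<Rightarrow> complex)) \<Rightarrow> 'n::finite l2_graph \<Rightarrow> bool" where
  "spectral_resolution E L \<longleftrightarrow> spectral_measure E \<and> L = spectral_integral E (\<lambda>s. s)"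

text \<open>
  The functional calculus \<open>\<phi>(L)\<close>. By the spectral theorem a self-adjoint \<open>L\<close> has a
  spectral resolution, unique up to equality almost everywhere, so the existential quantifier
  involves no choice.
\<close>

definition functional_calculus :: "'n::finite l2_graph \<Rightarrow> (real \<Rightarrow> real) \<Rightarrow> 'n l2_graph" where
  "functional_calculus L \<phi> = {(f, g). \<exists>E. spectral_resolution E L \<and> (f, g) \<in> spectral_integral E \<phi>}"

definition heat_semigroup :: "'n::finite l2_graph \<Rightarrow> real \<Rightarrow> 'n l2_graph" where
  "heat_semigroup L t = functional_calculus L (\<lambda>s. exp (- (t * s)))"

text \<open>
  The pointwise fractional power \<open>L\<^sup>\<sigma> f(x)\<close>, where \<open>u t\<close> is the fixed representative
  of \<open>e\<^bsup>-tL\<^esup> f\<close>. The Bochner integral is 0 for a non-integrable integrand, hence the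
  separate predicate for convergence of the integral.
\<close>

definition frac_power_integrand ::
    "real \<Rightarrow> (real \<Rightarrow> real ^ 'n \<Rightarrow> complex) \<Rightarrow> (real ^ 'n \<Rightarrow> complex) \<Rightarrow> real ^ 'n \<Rightarrow> real \<Rightarrow> complex" where
  "frac_power_integrand \<sigma> u f x t = (u t x - f x) / complex_of_real (t powr (1 + \<sigma>))"

definition frac_power_converges ::
    "real \<Rightarrow> (real \<Rightarrow> real ^ 'n \<Rightarrow> complex) \<Rightarrow> (real ^ 'n \<Rightarrow> complex) \<Rightarrow> real ^ 'n \<Rightarrow> bool" where
  "frac_power_converges \<sigma> u f x \<longleftrightarrow> set_integrable lebesgue {0<..} (frac_power_integrand \<sigma> u f x)"

definition frac_power ::
    "real \<Rightarrow> (real \<Rightarrow> real ^ 'n \<Rightarrow> complex) \<Rightarrow> (real ^ 'n \<Rightarrow> complex) \<Rightarrow> real ^ 'n \<Rightarrow> complex" where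
  "frac_power \<sigma> u f x =
     complex_of_real (1 / Gamma (- \<sigma>)) * (LINT t:{0<..}|lebesgue. frac_power_integrand \<sigma> u f x t)"

end

theory Submission
  imports Defs
begin

text \<open>
  Put \<open>w t = f x - u t x\<close> and \<open>p t = min t 1\<close> (that is, \<open>two_power 1 0\<close>). Since \<open>-1 / \<Gamma>(-\<sigma>) = \<sigma> / \<Gamma>(1 - \<sigma>)\<close>, the fractional
  power is the integral of \<open>w\<close> against the positive weight \<open>\<sigma> / \<Gamma>(1 - \<sigma>) t\<^bsup>-1-\<sigma>\<^esup>\<close>. The total mass of
  \<open>p\<close> against this weight is \<open>1 / \<Gamma>(2 - \<sigma>)\<close>, which tends to 1 at both ends of \<open>(0, 1)\<close>; as
  \<open>\<sigma> \<rightarrow> 1\<close> the mass concentrates at \<open>t = 0\<close>, where \<open>w / p\<close> tends to \<open>Lf x\<close>, and as \<open>\<sigma> \<rightarrow> 0\<close> it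
  concentrates at \<open>t = \<infinity>\<close>, where \<open>w / p\<close> tends to \<open>f x\<close>.
\<close>

section \<open>Mass of power functions against the weight on the half-line\<close>

definition two_power :: "real \<Rightarrow> real \<Rightarrow> real \<Rightarrow> real" where
  "two_power a b t = (if t \<le> 1 then t powr a else t powr b)"

lemma two_power_nonneg: "0 \<le> two_power a b t"
  by (simp add: two_power_def)

text \<open>The exponent a governs the behaviour at 0 and b that at infinity, so the integrals over
  the two sides of 1 converge separately. Besides \<open>two_power 1 0\<close>, the cases
  \<open>two_power 2 0\<close> and \<open>two_power 1 (-1)\<close> serve as error terms that are
  smaller at 0 and at infinity, respectively.\<close>

lemma has_integral_two_power:
  assumes "b < \<sigma>" "\<sigma> < a"
  shows "((\<lambda>t. t powr (-1 - \<sigma>) * two_power a b t) has_integral 1 / (a - \<sigma>) + 1 / (\<sigma> - b)) {0<..}"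
proof -
  let ?g = "\<lambda>t. t powr (-1 - \<sigma>) * two_power a b t"
  have "((\<lambda>t. t powr (a - \<sigma> - 1)) has_integral 1 / (a - \<sigma>)) {0..1::real}"
    using has_integral_powr_from_0[of "a - \<sigma> - 1" 1] assms by simp
  then have "(?g has_integral 1 / (a - \<sigma>)) {0..1}"
    by (rule has_integral_eq[rotated]) (auto simp: two_power_def powr_add[symmetric] algebra_simps)
  moreover have "((\<lambda>t. t powr (b - \<sigma> - 1)) has_integral 1 / (\<sigma> - b)) {1::real..}"
    using has_integral_powr_to_inf[of "b - \<sigma> - 1" 1] assms by (simp add: minus_divide_right)
  \<comment> \<open>At t = 1 the case distinction selects the exponent a, which is harmless because
    both powers equal 1 there.\<close>
  then have "(?g has_integral 1 / (\<sigma> - b)) {1..}"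
    by (rule has_integral_eq[rotated]) (auto simp: two_power_def powr_add[symmetric] algebra_simps)
  moreover have "{0..1} \<inter> {1::real..} = {1}" by auto
  ultimately have "(?g has_integral 1 / (a - \<sigma>) + 1 / (\<sigma> - b)) ({0..1} \<union> {1..})"
    by (intro has_integral_Un) auto
  also have "{0..1} \<union> {1::real..} = {0..}" by auto
  finally show ?thesis
  proof (rule iffD1[OF has_integral_spike_set_eq, rotated 2])
    have "{t \<in> {0..} - {0<..}. ?g t \<noteq> 0} \<subseteq> {0}" by auto
    then show "negligible {t \<in> {0..} - {0<..}. ?g t \<noteq> 0}"
      using negligible_subset by blast
    have "{t \<in> {0<..} - {0..}. ?g t \<noteq> 0} = {}" by auto
    then show "negligible {t \<in> {0<..} - {0..}. ?g t \<noteq> 0}" by (simp only: negligible_empty)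
  qed
qed

lemma set_integrable_two_power:
  assumes "b < \<sigma>" "\<sigma> < a"
  shows "set_integrable lebesgue {0<..} (\<lambda>t. t powr (-1 - \<sigma>) * two_power a b t)"
  using has_integral_two_power[OF assms]
  by (intro nonnegative_absolutely_integrable_1) (auto simp: two_power_nonneg)

lemma set_integral_two_power:
  assumes "b < \<sigma>" "\<sigma> < a"
  shows "(LINT t:{0<..}|lebesgue. t powr (-1 - \<sigma>) * two_power a b t) = 1 / (a - \<sigma>) + 1 / (\<sigma> - b)"
  using set_lebesgue_integral_eq_integral(2)[OF set_integrable_two_power[OF assms]]
    integral_unique[OF has_integral_two_power[OF assms]] by simp

text \<open>Domination by a multiple of \<open>two_power 1 0\<close>, whose weighted integral is
  finite precisely because 0 < \<sigma> < 1. This yields the convergence of the fractional power and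
  also permits splitting integrals in the estimate below.\<close>

lemma set_integrable_powr_scaleR:
  fixes w :: "real \<Rightarrow> complex"
  assumes "w \<in> borel_measurable (lebesgue_on {0<..})"
    and "0 < \<sigma>" "\<sigma> < 1"
    and "\<And>t. t > 0 \<Longrightarrow> norm (w t) \<le> M * two_power 1 0 t"
  shows "set_integrable lebesgue {0<..} (\<lambda>t. t powr (-1 - \<sigma>) *\<^sub>R w t)"
proof (rule set_integrable_bound)
  show "set_integrable lebesgue {0<..} (\<lambda>t. M * (t powr (-1 - \<sigma>) * two_power 1 0 t))"
    using set_integrable_two_power assms by (intro set_integrable_mult_right) auto
  have "(\<lambda>t. t powr (-1 - \<sigma>)) \<in> borel_measurable (lebesgue_on {0<..})"
    by (intro measurable_restrict_space1 measurable_completion) simp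
  then have "(\<lambda>t. t powr (-1 - \<sigma>) *\<^sub>R w t) \<in> borel_measurable (lebesgue_on {0<..})"
    using assms(1) by simp
  then show "set_borel_measurable lebesgue {0<..} (\<lambda>t. t powr (-1 - \<sigma>) *\<^sub>R w t)"
    unfolding set_borel_measurable_def by (subst (asm) borel_measurable_restrict_space_iff) auto
  have "norm (t powr (-1 - \<sigma>) *\<^sub>R w t) \<le> norm (M * (t powr (-1 - \<sigma>) * two_power 1 0 t))"
    if "t > 0" for t
    using mult_left_mono[OF assms(4)[OF that], of "t powr (-1 - \<sigma>)"]
    by (simp add: algebra_simps)
  then show "AE t in lebesgue. t \<in> {0<..} \<longrightarrow>
      norm (t powr (-1 - \<sigma>) *\<^sub>R w t) \<le> norm (M * (t powr (-1 - \<sigma>) * two_power 1 0 t))"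
    by auto
qed

section \<open>The normalized integral of Balakrishnan's formula and its distance from the
  limit\<close>

definition balakrishnan :: "real \<Rightarrow> (real \<Rightarrow> complex) \<Rightarrow> complex" where
  "balakrishnan \<sigma> w =
     (\<sigma> * rGamma (1 - \<sigma>)) *\<^sub>R (LINT t:{0<..}|lebesgue. t powr (-1 - \<sigma>) *\<^sub>R w t)"

text \<open>The reciprocal Gamma function is entire, so no exception arises when 1 - \<sigma>
  reaches the pole of Gamma at 0. This is why the normalization is written with
  \<open>rGamma\<close>.\<close>

lemma tendsto_rGamma:
  fixes g :: "'a \<Rightarrow> real"
  assumes "(g \<longlongrightarrow> l) F"
  shows "((\<lambda>z. rGamma (g z)) \<longlongrightarrow> rGamma l) F"
  using assms by (rule isCont_tendsto_compose[rotated]) (intro continuous_intros)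

text \<open>The recurrence of the reciprocal Gamma function supplies the factor 1 - \<sigma> that
  cancels the pole of the integral at \<sigma> = 1.\<close>

lemma rGamma_two_power_mass:
  fixes \<sigma> :: real
  assumes "0 < \<sigma>" "\<sigma> < 1"
  shows "\<sigma> * rGamma (1 - \<sigma>) * (1 / (1 - \<sigma>) + 1 / \<sigma>) = rGamma (2 - \<sigma>)"
proof -
  have "rGamma (1 - \<sigma>) = (1 - \<sigma>) * rGamma (2 - \<sigma>)"
    using rGamma_plus1[of "1 - \<sigma>"] by simp
  moreover have "1 / (1 - \<sigma>) + 1 / \<sigma> = 1 / (\<sigma> * (1 - \<sigma>))"
    using assms by (simp add: add_frac_eq)
  ultimately show ?thesis using assms by simp
qed

text \<open>By the mass identity, \<open>rGamma (2 - \<sigma>) *\<^sub>R A\<close> is the normalized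
  integral of \<open>two_power 1 0 t *\<^sub>R A\<close>. The difference is therefore a single
  integral, and the pointwise bound can be integrated against the positive weight. The bound with M
  serves to make the integrals converge.\<close>

lemma balakrishnan_estimate:
  fixes w :: "real \<Rightarrow> complex"
  assumes w: "w \<in> borel_measurable (lebesgue_on {0<..})"
    and \<sigma>: "0 < \<sigma>" "\<sigma> < 1" "b < \<sigma>" "\<sigma> < a"
    and M: "\<And>t. t > 0 \<Longrightarrow> norm (w t) \<le> M * two_power 1 0 t"
    and K: "\<And>t. t > 0 \<Longrightarrow>
      norm (w t - two_power 1 0 t *\<^sub>R A) \<le> \<epsilon> * two_power 1 0 t + K * two_power a b t"
  shows "norm (balakrishnan \<sigma> w - rGamma (2 - \<sigma>) *\<^sub>R A)
    \<le> \<epsilon> * rGamma (2 - \<sigma>) + K * (\<sigma> * rGamma (1 - \<sigma>) * (1 / (a - \<sigma>) + 1 / (\<sigma> - b)))"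
proof -
  define k where "k t = t powr (-1 - \<sigma>)" for t :: real
  define c where "c = \<sigma> * rGamma (1 - \<sigma>)"
  have c: "c \<ge> 0"
    using \<sigma> Gamma_real_pos[of "1 - \<sigma>"] by (simp add: c_def rGamma_inverse_Gamma)
  have kw: "set_integrable lebesgue {0<..} (\<lambda>t. k t *\<^sub>R w t)"
    unfolding k_def by (rule set_integrable_powr_scaleR[OF w \<sigma>(1,2) M])
  have kp: "set_integrable lebesgue {0<..} (\<lambda>t. k t * two_power 1 0 t)"
    unfolding k_def using \<sigma> by (intro set_integrable_two_power) auto
  have kq: "set_integrable lebesgue {0<..} (\<lambda>t. k t * two_power a b t)"
    unfolding k_def using \<sigma> by (intro set_integrable_two_power) auto
  have ip: "(LINT t:{0<..}|lebesgue. k t * two_power 1 0 t) = 1 / (1 - \<sigma>) + 1 / \<sigma>"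
    unfolding k_def using set_integral_two_power[of 0 \<sigma> 1] \<sigma> by simp
  have iq: "(LINT t:{0<..}|lebesgue. k t * two_power a b t) = 1 / (a - \<sigma>) + 1 / (\<sigma> - b)"
    unfolding k_def by (rule set_integral_two_power[OF \<sigma>(3,4)])
  have kpA: "set_integrable lebesgue {0<..} (\<lambda>t. (k t * two_power 1 0 t) *\<^sub>R A)"
    using kp by (rule set_integrable_scaleR_left[rotated])
  have ipA: "(LINT t:{0<..}|lebesgue. (k t * two_power 1 0 t) *\<^sub>R A) = (1 / (1 - \<sigma>) + 1 / \<sigma>) *\<^sub>R A"
    unfolding ip[symmetric] using kp
    by (simp add: set_lebesgue_integral_def set_integrable_def flip: integral_scaleR_left)
  have d: "set_integrable lebesgue {0<..} (\<lambda>t. k t *\<^sub>R w t - (k t * two_power 1 0 t) *\<^sub>R A)"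
    using kw kpA by (rule set_integral_diff)
  have "balakrishnan \<sigma> w - rGamma (2 - \<sigma>) *\<^sub>R A
      = c *\<^sub>R (LINT t:{0<..}|lebesgue. k t *\<^sub>R w t - (k t * two_power 1 0 t) *\<^sub>R A)"
    unfolding set_integral_diff(2)[OF kw kpA] ipA balakrishnan_def k_def[symmetric] c_def[symmetric]
      rGamma_two_power_mass[OF \<sigma>(1,2), symmetric]
    by (simp add: scaleR_diff_right)
  then have "norm (balakrishnan \<sigma> w - rGamma (2 - \<sigma>) *\<^sub>R A)
      = c * norm (LINT t:{0<..}|lebesgue. k t *\<^sub>R w t - (k t * two_power 1 0 t) *\<^sub>R A)"
    using c by simp
  also have "\<dots> \<le> c * (LINT t:{0<..}|lebesgue. norm (k t *\<^sub>R w t - (k t * two_power 1 0 t) *\<^sub>R A))"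
    using c d by (intro mult_left_mono set_integral_norm_bound) auto
  also have "\<dots> \<le> c * (LINT t:{0<..}|lebesgue. \<epsilon> * (k t * two_power 1 0 t) + K * (k t * two_power a b t))"
  proof (intro mult_left_mono set_integral_mono c)
    show "set_integrable lebesgue {0<..} (\<lambda>t. norm (k t *\<^sub>R w t - (k t * two_power 1 0 t) *\<^sub>R A))"
      using d by (rule set_integrable_norm)
    show "set_integrable lebesgue {0<..} (\<lambda>t. \<epsilon> * (k t * two_power 1 0 t) + K * (k t * two_power a b t))"
      using kp kq by (intro set_integral_add set_integrable_mult_right)
    fix t :: real assume "t \<in> {0<..}"
    then have "k t * norm (w t - two_power 1 0 t *\<^sub>R A)
        \<le> k t * (\<epsilon> * two_power 1 0 t + K * two_power a b t)"
      using K by (intro mult_left_mono) (auto simp: k_def)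
    moreover have "norm (k t *\<^sub>R w t - (k t * two_power 1 0 t) *\<^sub>R A)
        = k t * norm (w t - two_power 1 0 t *\<^sub>R A)"
    proof -
      have "k t *\<^sub>R w t - (k t * two_power 1 0 t) *\<^sub>R A = k t *\<^sub>R (w t - two_power 1 0 t *\<^sub>R A)"
        by (simp add: scaleR_diff_right)
      then show ?thesis by (simp add: k_def)
    qed
    ultimately show "norm (k t *\<^sub>R w t - (k t * two_power 1 0 t) *\<^sub>R A)
        \<le> \<epsilon> * (k t * two_power 1 0 t) + K * (k t * two_power a b t)"
      by (simp add: algebra_simps)
  qed
  also have "\<dots> = c * (\<epsilon> * (1 / (1 - \<sigma>) + 1 / \<sigma>) + K * (1 / (a - \<sigma>) + 1 / (\<sigma> - b)))"
    using kp kq by (simp add: set_integral_add set_integrable_mult_right ip iq)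
  also have "\<dots> = \<epsilon> * (c * (1 / (1 - \<sigma>) + 1 / \<sigma>)) + K * (c * (1 / (a - \<sigma>) + 1 / (\<sigma> - b)))"
    by (simp only: distrib_left mult.left_commute)
  also have "c * (1 / (1 - \<sigma>) + 1 / \<sigma>) = rGamma (2 - \<sigma>)"
    unfolding c_def by (rule rGamma_two_power_mass[OF \<sigma>(1,2)])
  finally show ?thesis by (simp add: c_def)
qed

text \<open>Common to both ends of (0, 1). However large K must be for a given \<epsilon>, its term
  dies because the mass of \<open>two_power a b\<close> tends to 0 by \<open>lost\<close>; what
  remains is \<epsilon> times a mass tending to 1.\<close>

lemma tendsto_balakrishnan:
  fixes w :: "real \<Rightarrow> complex"
  assumes w: "w \<in> borel_measurable (lebesgue_on {0<..})"
    and ev: "\<forall>\<^sub>F \<sigma> in F. 0 < \<sigma> \<and> \<sigma> < 1 \<and> b < \<sigma> \<and> \<sigma> < a"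
    and mass: "((\<lambda>\<sigma>. rGamma (2 - \<sigma>)) \<longlongrightarrow> 1) F"
    and lost: "((\<lambda>\<sigma>. \<sigma> * rGamma (1 - \<sigma>) * (1 / (a - \<sigma>) + 1 / (\<sigma> - b))) \<longlongrightarrow> 0) F"
    and M: "\<And>t. t > 0 \<Longrightarrow> norm (w t) \<le> M * two_power 1 0 t"
    and K: "\<And>\<epsilon>. \<epsilon> > 0 \<Longrightarrow> \<exists>K. \<forall>t>0.
      norm (w t - two_power 1 0 t *\<^sub>R A) \<le> \<epsilon> * two_power 1 0 t + K * two_power a b t"
  shows "((\<lambda>\<sigma>. balakrishnan \<sigma> w) \<longlongrightarrow> A) F"
proof -
  have "((\<lambda>\<sigma>. balakrishnan \<sigma> w - rGamma (2 - \<sigma>) *\<^sub>R A) \<longlongrightarrow> 0) F"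
  proof (rule tendstoI)
    fix e :: real assume "e > 0"
    then obtain K where K: "\<And>t. t > 0 \<Longrightarrow>
        norm (w t - two_power 1 0 t *\<^sub>R A) \<le> e / 2 * two_power 1 0 t + K * two_power a b t"
      using K[of "e / 2"] by auto
    have "((\<lambda>\<sigma>. e / 2 * rGamma (2 - \<sigma>)
        + K * (\<sigma> * rGamma (1 - \<sigma>) * (1 / (a - \<sigma>) + 1 / (\<sigma> - b)))) \<longlongrightarrow> e / 2 * 1 + K * 0) F"
      by (intro tendsto_intros mass lost)
    then have "\<forall>\<^sub>F \<sigma> in F. e / 2 * rGamma (2 - \<sigma>)
        + K * (\<sigma> * rGamma (1 - \<sigma>) * (1 / (a - \<sigma>) + 1 / (\<sigma> - b))) < e"
      by (rule order_tendstoD(2)) (use \<open>e > 0\<close> in simp)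
    with ev show "\<forall>\<^sub>F \<sigma> in F. dist (balakrishnan \<sigma> w - rGamma (2 - \<sigma>) *\<^sub>R A) 0 < e"
    proof eventually_elim
      case (elim \<sigma>)
      then show ?case
        using balakrishnan_estimate[OF w _ _ _ _ M K, of \<sigma>] by simp
    qed
  qed
  moreover have "((\<lambda>\<sigma>. rGamma (2 - \<sigma>) *\<^sub>R A) \<longlongrightarrow> 1 *\<^sub>R A) F"
    by (intro tendsto_intros mass)
  ultimately show ?thesis using tendsto_add by fastforce
qed

section \<open>The limits at the two ends of (0, 1)\<close>

lemma balakrishnan_at_left_1:
  fixes w :: "real \<Rightarrow> complex"
  assumes w: "w \<in> borel_measurable (lebesgue_on {0<..})"
    and M: "\<And>t. t > 0 \<Longrightarrow> norm (w t) \<le> M * two_power 1 0 t"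
    and A: "((\<lambda>t. w t / of_real t) \<longlongrightarrow> A) (at_right 0)"
  shows "((\<lambda>\<sigma>. balakrishnan \<sigma> w) \<longlongrightarrow> A) (at_left 1)"
\<comment> \<open>With exponent 2 at 0, the integral 1 / (2 - \<sigma>) + 1 / \<sigma> stays bounded
  as \<sigma> tends to 1, while the prefactor tends to \<open>rGamma 0 = 0\<close>.\<close>
proof (rule tendsto_balakrishnan[OF w _ _ _ M, where a = 2 and b = 0])
  show "\<forall>\<^sub>F \<sigma> in at_left 1. 0 < \<sigma> \<and> \<sigma> < 1 \<and> 0 < \<sigma> \<and> \<sigma> < (2::real)"
    using eventually_at_left_real[of 0 1] by (auto elim!: eventually_mono)
  have "((\<lambda>\<sigma>::real. rGamma (2 - \<sigma>)) \<longlongrightarrow> rGamma (2 - 1)) (at_left 1)"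
    by (intro tendsto_rGamma tendsto_intros)
  then show "((\<lambda>\<sigma>::real. rGamma (2 - \<sigma>)) \<longlongrightarrow> 1) (at_left 1)" by simp
  have "((\<lambda>\<sigma>::real. \<sigma> * rGamma (1 - \<sigma>) * (1 / (2 - \<sigma>) + 1 / (\<sigma> - 0))) \<longlongrightarrow>
      1 * rGamma (1 - 1) * (1 / (2 - 1) + 1 / (1 - 0))) (at_left 1)"
    by (intro tendsto_rGamma tendsto_intros) auto
  then show "((\<lambda>\<sigma>::real. \<sigma> * rGamma (1 - \<sigma>) * (1 / (2 - \<sigma>) + 1 / (\<sigma> - 0))) \<longlongrightarrow> 0) (at_left 1)"
    by simp
next
  fix \<epsilon> :: real assume "\<epsilon> > 0"
  then have "\<forall>\<^sub>F t in at_right 0. dist (w t / of_real t) A < \<epsilon>"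
    using A by (rule tendstoD[rotated])
  then obtain d where d: "d > 0" "\<And>t. 0 < t \<Longrightarrow> t < d \<Longrightarrow> dist (w t / of_real t) A < \<epsilon>"
    unfolding eventually_at_right_field by auto
  \<comment> \<open>The cap at 1 ensures that \<open>two_power 1 0 t = t\<close> for 0 < t <
    \<delta>, and that \<delta> squared is at most 1, as needed for t > 1.\<close>
  define \<delta> where "\<delta> = min d 1"
  have \<delta>: "0 < \<delta>" "\<delta> \<le> 1" using d by (auto simp: \<delta>_def)
  have M0: "M \<ge> 0" using order_trans[OF norm_ge_zero M[of 1]] by (simp add: two_power_def)
  have "norm (w t - two_power 1 0 t *\<^sub>R A)
      \<le> \<epsilon> * two_power 1 0 t + (M + norm A) / \<delta>\<^sup>2 * two_power 2 0 t" if t: "t > 0" for t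
  proof (cases "t < \<delta>")
    case True
    have "w t - two_power 1 0 t *\<^sub>R A = t *\<^sub>R (w t / of_real t - A)"
      using True t \<delta> by (simp add: two_power_def scaleR_conv_of_real right_diff_distrib)
    then have "norm (w t - two_power 1 0 t *\<^sub>R A) = t * norm (w t / of_real t - A)"
      using t by simp
    also have "\<dots> \<le> t * \<epsilon>"
      using d(2)[of t] True t by (intro mult_left_mono) (auto simp: \<delta>_def dist_norm)
    also have "\<dots> = \<epsilon> * two_power 1 0 t"
      using True t \<delta> by (simp add: two_power_def)
    finally show ?thesis
      using M0 by (simp add: two_power_nonneg add_increasing2)
  next
    case False
    \<comment> \<open>Away from 0 the two powers are comparable, so the crude bound by M and the
      norm of A is absorbed into the error term.\<close>
    have "\<delta>\<^sup>2 * two_power 1 0 t \<le> two_power 2 0 t"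
    proof (cases "t \<le> 1")
      case True
      have "\<delta>\<^sup>2 * t \<le> \<delta>\<^sup>2 * 1" using True by (intro mult_left_mono) auto
      also have "\<dots> \<le> t\<^sup>2" using False \<delta> by (simp add: power_mono)
      finally show ?thesis using True t by (simp add: two_power_def)
    next
      case False
      then show ?thesis using \<delta> t by (simp add: two_power_def power_le_one)
    qed
    then have p: "two_power 1 0 t \<le> two_power 2 0 t / \<delta>\<^sup>2"
      using \<delta> by (simp add: field_simps)
    have "norm (w t - two_power 1 0 t *\<^sub>R A) \<le> norm (w t) + norm (two_power 1 0 t *\<^sub>R A)"
      by (rule norm_triangle_ineq4)
    also have "\<dots> \<le> (M + norm A) * two_power 1 0 t"
      using M[OF t] by (simp add: two_power_nonneg algebra_simps)
    also have "\<dots> \<le> (M + norm A) * (two_power 2 0 t / \<delta>\<^sup>2)"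
      using M0 p by (intro mult_left_mono) auto
    finally show ?thesis
      using \<open>\<epsilon> > 0\<close> by (simp add: two_power_nonneg add_increasing)
  qed
  then show "\<exists>K. \<forall>t>0. norm (w t - two_power 1 0 t *\<^sub>R A)
      \<le> \<epsilon> * two_power 1 0 t + K * two_power 2 0 t"
    by blast
qed

text \<open>Mirror image of the limit at 1: with exponent -1 at infinity the integral 1 / (1 -
  \<sigma>) + 1 / (\<sigma> + 1) stays bounded as \<sigma> tends to 0, and the prefactor vanishes
  through its factor \<sigma>.\<close>

lemma balakrishnan_at_right_0:
  fixes w :: "real \<Rightarrow> complex"
  assumes w: "w \<in> borel_measurable (lebesgue_on {0<..})"
    and M: "\<And>t. t > 0 \<Longrightarrow> norm (w t) \<le> M * two_power 1 0 t"
    and A: "(w \<longlongrightarrow> A) at_top"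
  shows "((\<lambda>\<sigma>. balakrishnan \<sigma> w) \<longlongrightarrow> A) (at_right 0)"
proof (rule tendsto_balakrishnan[OF w _ _ _ M, where a = 1 and b = "-1"])
  show "\<forall>\<^sub>F \<sigma> in at_right 0. 0 < \<sigma> \<and> \<sigma> < 1 \<and> -1 < \<sigma> \<and> \<sigma> < (1::real)"
    using eventually_at_right_real[of 0 1] by (auto elim!: eventually_mono)
  have "((\<lambda>\<sigma>::real. rGamma (2 - \<sigma>)) \<longlongrightarrow> rGamma (2 - 0)) (at_right 0)"
    by (intro tendsto_rGamma tendsto_intros)
  moreover have "rGamma (2::real) = 1" using rGamma_plus1[of "1::real"] by simp
  ultimately show "((\<lambda>\<sigma>::real. rGamma (2 - \<sigma>)) \<longlongrightarrow> 1) (at_right 0)" by simp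
  have "((\<lambda>\<sigma>::real. \<sigma> * rGamma (1 - \<sigma>) * (1 / (1 - \<sigma>) + 1 / (\<sigma> - -1))) \<longlongrightarrow>
      0 * rGamma (1 - 0) * (1 / (1 - 0) + 1 / (0 - -1))) (at_right 0)"
    by (intro tendsto_rGamma tendsto_intros) auto
  then show "((\<lambda>\<sigma>::real. \<sigma> * rGamma (1 - \<sigma>) * (1 / (1 - \<sigma>) + 1 / (\<sigma> - -1))) \<longlongrightarrow> 0) (at_right 0)"
    by simp
next
  fix \<epsilon> :: real assume "\<epsilon> > 0"
  then have "\<forall>\<^sub>F t in at_top. dist (w t) A < \<epsilon>"
    using A by (rule tendstoD[rotated])
  then obtain S where S: "\<And>t. t \<ge> S \<Longrightarrow> dist (w t) A < \<epsilon>"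
    unfolding eventually_at_top_linorder by auto
  \<comment> \<open>Since T is at least 1, \<open>two_power 1 0 t = 1\<close> for t > T, where w is
    compared directly with A.\<close>
  define T where "T = max S 1"
  have T: "T \<ge> 1" "T \<ge> S" by (auto simp: T_def)
  have M0: "M \<ge> 0" using order_trans[OF norm_ge_zero M[of 1]] by (simp add: two_power_def)
  have "norm (w t - two_power 1 0 t *\<^sub>R A)
      \<le> \<epsilon> * two_power 1 0 t + (M + norm A) * T * two_power 1 (-1) t" if t: "t > 0" for t
  proof (cases "t > T")
    case True
    then have "norm (w t - two_power 1 0 t *\<^sub>R A) \<le> \<epsilon> * two_power 1 0 t"
      using S[of t] T by (simp add: two_power_def dist_norm)
    then show ?thesis
      using M0 T by (simp add: two_power_nonneg add_increasing2)
  next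
    case False
    \<comment> \<open>For t up to 1 both powers equal t; for 1 < t \<le> T the claim is 1 \<le> T /
      t.\<close>
    have p: "two_power 1 0 t \<le> T * two_power 1 (-1) t"
      using False t T by (simp add: two_power_def powr_minus field_simps)
    have "norm (w t - two_power 1 0 t *\<^sub>R A) \<le> norm (w t) + norm (two_power 1 0 t *\<^sub>R A)"
      by (rule norm_triangle_ineq4)
    also have "\<dots> \<le> (M + norm A) * two_power 1 0 t"
      using M[OF t] by (simp add: two_power_nonneg algebra_simps)
    also have "\<dots> \<le> (M + norm A) * (T * two_power 1 (-1) t)"
      using M0 p by (intro mult_left_mono) auto
    finally show ?thesis
      using \<open>\<epsilon> > 0\<close> by (simp add: two_power_nonneg add_increasing mult.assoc)
  qed
  then show "\<exists>K. \<forall>t>0. norm (w t - two_power 1 0 t *\<^sub>R A)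
      \<le> \<epsilon> * two_power 1 0 t + K * two_power 1 (-1) t"
    by blast
qed

text \<open>The limits control \<open>w\<close> near 0 and near \<open>\<infinity>\<close>; the power bounds cover the compact range in between.\<close>

lemma two_power_bound:
  fixes w :: "real \<Rightarrow> complex"
  assumes zero: "((\<lambda>t. w t / of_real t) \<longlongrightarrow> A) (at_right 0)"
    and inf: "(w \<longlongrightarrow> B) at_top"
    and large: "\<And>t. t \<ge> 1 \<Longrightarrow> norm (w t / of_real t) \<le> C1 * t powr (- \<eta>1)"
    and small: "\<And>t. 0 < t \<Longrightarrow> t \<le> 1 \<Longrightarrow> norm (w t) \<le> C2 * t powr \<eta>2"
    and pos: "\<eta>1 > 0" "C1 > 0" "\<eta>2 > 0" "C2 > 0"
  obtains M where "\<And>t. t > 0 \<Longrightarrow> norm (w t) \<le> M * two_power 1 0 t"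
proof -
  have "\<forall>\<^sub>F t in at_right 0. dist (w t / of_real t) A < 1"
    using zero by (rule tendstoD) simp
  then obtain d where d: "d > 0" "\<And>t. 0 < t \<Longrightarrow> t < d \<Longrightarrow> dist (w t / of_real t) A < 1"
    unfolding eventually_at_right_field by auto
  have "\<forall>\<^sub>F t in at_top. dist (w t) B < 1"
    using inf by (rule tendstoD) simp
  then obtain S where S: "\<And>t. t \<ge> S \<Longrightarrow> dist (w t) B < 1"
    unfolding eventually_at_top_linorder by auto
  define T where "T = max S 1"
  \<comment> \<open>One summand for each range, in order: t \<le> 1 with t < d; d \<le> t \<le> 1; t
    \<ge> T; and 1 < t < T. In the second range w is at most C2, and t / d is at least 1; in the
    fourth it is at most C1 * t. The signs of the exponents are used to bound the powers of t by
    1.\<close>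
  define M where "M = (norm A + 1) + C2 / d + (norm B + 1) + C1 * T"
  have M: "norm A + 1 \<le> M" "C2 / d \<le> M" "norm B + 1 \<le> M" "C1 * T \<le> M"
    using d pos by (auto simp: M_def T_def intro!: add_increasing add_increasing2)
  have "norm (w t) \<le> M * two_power 1 0 t" if t: "t > 0" for t
  proof (cases "t \<le> 1")
    case True
    have "norm (w t) \<le> M * t"
    proof (cases "t < d")
      case True
      have "norm (w t / of_real t) \<le> norm A + 1"
        using d(2)[OF t True] norm_triangle_ineq2[of "w t / of_real t" A] by (simp add: dist_norm)
      also note M(1)
      finally show ?thesis using t by (simp add: norm_divide field_simps)
    next
      case False
      have "norm (w t) \<le> C2 * t powr \<eta>2" by (rule small[OF t True])
      also have "\<dots> \<le> C2 * 1"
        using t True pos by (intro mult_left_mono powr_le1) auto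
      also have "\<dots> \<le> C2 / d * t" using False d pos by (simp add: field_simps)
      also have "\<dots> \<le> M * t" using M t by (intro mult_right_mono) auto
      finally show ?thesis .
    qed
    then show ?thesis using True t by (simp add: two_power_def)
  next
    case False
    have "norm (w t) \<le> M"
    proof (cases "t \<ge> T")
      case True
      then have "norm (w t) \<le> norm B + 1"
        using S[of t] norm_triangle_ineq2[of "w t" B] by (simp add: dist_norm T_def)
      then show ?thesis using M by simp
    next
      case tT: False
      have "norm (w t / of_real t) \<le> C1 * t powr (- \<eta>1)" using False by (intro large) simp
      also have "\<dots> \<le> C1 * t powr 0"
        using False pos by (intro mult_left_mono powr_mono) auto
      finally have "norm (w t) \<le> C1 * t" using t by (simp add: norm_divide field_simps)
      also have "\<dots> \<le> C1 * T" using tT pos by simp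
      finally show ?thesis using M by simp
    qed
    then show ?thesis using False t by (simp add: two_power_def)
  qed
  then show thesis by (rule that)
qed

section \<open>The fractional power as a normalized integral\<close>

lemma frac_power_integrand_eq:
  "frac_power_integrand \<sigma> u f x t = - (t powr (-1 - \<sigma>) *\<^sub>R (f x - u t x))"
proof -
  have "t powr (-1 - \<sigma>) = inverse (t powr (1 + \<sigma>))"
    using powr_minus[of t "1 + \<sigma>"] by (simp add: algebra_simps)
  then show ?thesis
    by (simp add: frac_power_integrand_def scaleR_conv_of_real divide_inverse algebra_simps)
qed

text \<open>The recurrence of \<open>rGamma\<close> at -\<sigma> gives the constant. No restriction
  on \<sigma> is needed: at the poles Gamma takes the default value 0, and so does its
  reciprocal.\<close>

lemma frac_power_eq_balakrishnan: "frac_power \<sigma> u f x = balakrishnan \<sigma> (\<lambda>t. f x - u t x)"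
proof -
  have "- (1 / Gamma (- \<sigma>)) = \<sigma> * rGamma (1 - \<sigma>)"
    using rGamma_plus1[of "- \<sigma>"] by (simp add: rGamma_inverse_Gamma divide_inverse add.commute)
  moreover have "frac_power \<sigma> u f x =
      (- (1 / Gamma (- \<sigma>))) *\<^sub>R (LINT t:{0<..}|lebesgue. t powr (-1 - \<sigma>) *\<^sub>R (f x - u t x))"
    unfolding frac_power_def frac_power_integrand_eq
    by (simp add: set_lebesgue_integral_def scaleR_conv_of_real)
  ultimately show ?thesis by (simp add: balakrishnan_def)
qed

theorem theorem1p3:
  fixes L :: "'n::finite l2_graph"
    and f Lf :: "real ^ 'n \<Rightarrow> complex"
    and u :: "real \<Rightarrow> real ^ 'n \<Rightarrow> complex"
    and x :: "real ^ 'n"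
    and \<eta>1 C1 \<eta>2 C2 :: real
  assumes "l2_operator L" and "densely_defined L" and "self_adjoint L" and "nonnegative L"
    and "(f, Lf) \<in> L"
    and "\<And>t. t > 0 \<Longrightarrow> (f, u t) \<in> heat_semigroup L t"
    and "(\<lambda>t. u t x) \<in> borel_measurable (lebesgue_on {0<..})"
    and "((\<lambda>t. (f x - u t x) / complex_of_real t) \<longlongrightarrow> Lf x) (at_right 0)"
    and "((\<lambda>t. u t x) \<longlongrightarrow> 0) at_top"
    and "\<eta>1 > 0" and "C1 > 0"
    and "\<And>t. t \<ge> 1 \<Longrightarrow> cmod ((f x - u t x) / complex_of_real t) \<le> C1 * t powr (- \<eta>1)"
    and "\<eta>2 > 0" and "C2 > 0"
    and "\<And>t. 0 < t \<Longrightarrow> t \<le> 1 \<Longrightarrow> cmod (f x - u t x) \<le> C2 * t powr \<eta>2"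
  shows "(\<forall>\<^sub>F \<sigma> in at_left 1. frac_power_converges \<sigma> u f x) \<and>
         ((\<lambda>\<sigma>. frac_power \<sigma> u f x) \<longlongrightarrow> Lf x) (at_left 1) \<and>
         (\<forall>\<^sub>F \<sigma> in at_right 0. frac_power_converges \<sigma> u f x) \<and>
         ((\<lambda>\<sigma>. frac_power \<sigma> u f x) \<longlongrightarrow> f x) (at_right 0)"
proof -
  let ?w = "\<lambda>t. f x - u t x"
  have w: "?w \<in> borel_measurable (lebesgue_on {0<..})"
    using assms(7) by simp
  have inf: "(?w \<longlongrightarrow> f x) at_top"
    using tendsto_diff[OF tendsto_const assms(9)] by simp
  \<comment> \<open>The power bounds enter only here; the rest rests on measurability, the two
    limits and this single bound.\<close>
  obtain M where M: "\<And>t. t > 0 \<Longrightarrow> norm (?w t) \<le> M * two_power 1 0 t"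
    using two_power_bound[OF assms(8) inf assms(12) assms(15) assms(10,11,13,14)] by blast
  have conv: "frac_power_converges \<sigma> u f x" if "0 < \<sigma>" "\<sigma> < 1" for \<sigma>
    using set_integrable_powr_scaleR[OF w that M]
    by (simp add: frac_power_converges_def frac_power_integrand_eq set_integrable_def)
  have "\<forall>\<^sub>F \<sigma> in at_left 1. frac_power_converges \<sigma> u f x"
    using eventually_at_left_real[of 0 1] conv by (auto elim!: eventually_mono)
  moreover have "\<forall>\<^sub>F \<sigma> in at_right 0. frac_power_converges \<sigma> u f x"
    using eventually_at_right_real[of 0 1] conv by (auto elim!: eventually_mono)
  ultimately show ?thesis
    using balakrishnan_at_left_1[OF w M assms(8)] balakrishnan_at_right_0[OF w M inf]
    by (simp add: frac_power_eq_balakrishnan)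
qed

end
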